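(* Let $g:\mathbb{R}\to\mathbb{R}$ be a derivator with $\infty\notin N_g^+$, let $\mathbb{F}\in\{\mathbb{R},\mathbb{C}\}$ and $\lambda\in\mathbb{F}\setminus\{0\}$. For any $s\in\mathbb{R}$, the function $\exp_g(\lambda;s)$ solves the differential equation $$v'_g(x)=\lambda v(x)\quad\text{for all }x\in(s-\delta,\infty),\qquad v(s)=1,$$ for all $\delta>0$ such that $(s-\delta,\infty)\subset\Omega_s$, where $\Omega_s$ is the maximal interval where $\sum_{n=0}^\infty\lambda^n\frac{g_{s,n}(x)}{n!}$ converges absolutely.
   Context: A derivator is a left-continuous non-decreasing function $g:\mathbb{R}\to\mathbb{R}$. $\mu_g$ denotes its Lebesgue–Stieltjes measure, characterized on Borel sets by $\mu_g([a,b))=g(b)-g(a)$ for $a<b$. $g$-monomials centered at $s$: $g_{s,0}\equiv 1$ and, for $n\ge 1$, $g_{s,n}(x)=n\int_{[s,x)}g_{s,n-1}\,d\mu_g$ if $x\ge s$ and $g_{s,n}(x)=-n\int_{[x,s)}g_{s,n-1}\,d\mu_g$ if $x<s$. The exponential series associated to $g$ centered at $s$ is $\exp_g(\lambda;s)(x)=\sum_{n=0}^\infty\lambda^n\frac{g_{s,n}(x)}{n!}$, defined at those points $x$ where the sum converges absolutely. Put $\Delta g(x)=g(x^+)-g(x)$, $D_g=\{x:\Delta g(x)>0\}$, $C_g=\{x: g$ is constant on $(x-\varepsilon,x+\varepsilon)$ for some $\varepsilon>0\}$. Write the open set $C_g$ as the disjoint union of its connected components $(a_n,b_n)$, $n\in\Lambda\subset\mathbb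 N$ (with $a_n,b_n\in\mathbb{R}\cup\{\pm\infty\}$). Set $N_g^-=\{a_n\}_{n\in\Lambda}\setminus D_g$, $N_g^+=\{b_n\}_{n\in\Lambda}\setminus D_g$. The assumption $\infty\notin N_g^+$ means no component of $C_g$ is unbounded above. $g$-derivative: let $\Omega\subset\mathbb{R}$ be open (usual topology) and such that $b_n\in\Omega$ whenever $x\in\Omega$ and $x\in(a_n,b_n)$, a component of $C_g$. For $f:\Omega\to\mathbb{F}$ and $x\in\Omega$ (when the limit exists): $f'_g(x)=\lim_{y\to x^+}\frac{f(y)-f(x)}{g(y)-g(x)}$ if $x\in D_g$; $f'_g(x)=\lim_{y\to x}\frac{f(y)-f(x)}{g(y)-g(x)}$ if $x\notin D_g\cup C_g$, where the limit is taken only from the right if $x\in N_g^+$ and only from the left if $x\in N_g^-$; $f'_g(x)=\lim_{y\to b_n^+}\frac{f(y)-f(b_n)}{g(y)-g(b_n)}$ if $x\in(a_n,b_n)$, a component of $C_g$. *)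

theory Defs
  imports "HOL-Analysis.Analysis"
begin

definition derivator :: "(real \<Rightarrow> real) \<Rightarrow> bool" where
  "derivator g \<longleftrightarrow> mono g \<and> (\<forall>x. continuous (at_left x) g)"

text \<open>
  The library's \<open>interval_measure\<close> expects a right-continuous function and measures
  intervals \<open>(a, b]\<close>. Since \<open>\<lambda>x. - g (- x)\<close> is right-continuous when \<open>g\<close> is
  left-continuous, reflecting its measure at the origin yields the Borel measure that
  assigns \<open>g b - g a\<close> to \<open>[a, b)\<close>; see \<open>emeasure_stieltjes_measure\<close>.
\<close>

definition stieltjes_measure :: "(real \<Rightarrow> real) \<Rightarrow> real measure" where
  "stieltjes_measure g = distr (interval_measure (\<lambda>x. - g (- x))) borel uminus"

lemma emeasure_stieltjes_measure:
  assumes "derivator g" and "a \<le> b"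
  shows "emeasure (stieltjes_measure g) {a..<b} = ennreal (g b - g a)"
proof -
  let ?h = "\<lambda>x. - g (- x)"
  have mono: "g x \<le> g y" if "x \<le> y" for x y
    using assms(1) that by (auto simp: derivator_def mono_def)
  have cont: "continuous (at_right x) ?h" for x
  proof -
    have "(g \<longlongrightarrow> g (- x)) (at_left (- x))"
      using assms(1) by (auto simp: derivator_def continuous_within)
    then have "((\<lambda>y. g (- y)) \<longlongrightarrow> g (- x)) (at_right x)"
      by (simp add: at_left_minus filterlim_filtermap)
    then show ?thesis
      by (auto simp: continuous_within intro: tendsto_minus)
  qed
  have vimage: "uminus -` {a..<b} = {- b<..- a}"
    by auto
  have "emeasure (stieltjes_measure g) {a..<b} = emeasure (interval_measure ?h) {- b<..- a}"
    unfolding stieltjes_measure_def by (subst emeasure_distr) (auto simp: vimage)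
  also have "\<dots> = ennreal (?h (- a) - ?h (- b))"
    using assms(2) by (intro emeasure_interval_measure_Ioc) (auto intro: mono cont)
  finally show ?thesis
    by simp
qed

primrec g_monomial :: "(real \<Rightarrow> real) \<Rightarrow> real \<Rightarrow> nat \<Rightarrow> real \<Rightarrow> real" where
  "g_monomial g s 0 = (\<lambda>x. 1)"
| "g_monomial g s (Suc n) = (\<lambda>x.
     if s \<le> x
     then real (Suc n) * (LINT y:{s..<x}|stieltjes_measure g. g_monomial g s n y)
     else - real (Suc n) * (LINT y:{x..<s}|stieltjes_measure g. g_monomial g s n y))"

definition exp_term ::
    "(real \<Rightarrow> real) \<Rightarrow> 'a::{real_normed_field,banach} \<Rightarrow> real \<Rightarrow> real \<Rightarrow> nat \<Rightarrow> 'a" where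
  "exp_term g c s x n = c ^ n * (of_real (g_monomial g s n x) / fact n)"

text \<open>Only meaningful at points of \<open>exp_abs_conv_set g c s\<close>.\<close>

definition exp_g ::
    "(real \<Rightarrow> real) \<Rightarrow> 'a::{real_normed_field,banach} \<Rightarrow> real \<Rightarrow> real \<Rightarrow> 'a" where
  "exp_g g c s x = (\<Sum>n. exp_term g c s x n)"

definition exp_abs_conv_set ::
    "(real \<Rightarrow> real) \<Rightarrow> 'a::{real_normed_field,banach} \<Rightarrow> real \<Rightarrow> real set" where
  "exp_abs_conv_set g c s = {x. summable (\<lambda>n. norm (exp_term g c s x n))}"

text \<open>
  The connected subsets of the real line are the intervals, so this is the largest
  interval around \<open>s\<close> on which the series converges absolutely.
\<close>

definition exp_max_interval ::
    "(real \<Rightarrow> real) \<Rightarrow> 'a::{real_normed_field,banach} \<Rightarrow> real \<Rightarrow> real set" where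
  "exp_max_interval g c s = connected_component_set (exp_abs_conv_set g c s) s"

definition jump :: "(real \<Rightarrow> real) \<Rightarrow> real \<Rightarrow> real" where
  "jump g x = Lim (at_right x) g - g x"

definition D_set :: "(real \<Rightarrow> real) \<Rightarrow> real set" where
  "D_set g = {x. jump g x > 0}"

definition C_set :: "(real \<Rightarrow> real) \<Rightarrow> real set" where
  "C_set g = {x. \<exists>\<epsilon>>0. g constant_on {x - \<epsilon><..<x + \<epsilon>}}"

text \<open>
  \<open>C_component g a b\<close>: the possibly unbounded open interval \<open>(a, b)\<close> is a connected
  component of \<open>C_set g\<close>. Library components are nonempty, so \<open>a\<close> and \<open>b\<close> are determined
  by the component.
\<close>

definition C_component :: "(real \<Rightarrow> real) \<Rightarrow> ereal \<Rightarrow> ereal \<Rightarrow> bool" where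
  "C_component g a b \<longleftrightarrow> {x. a < ereal x \<and> ereal x < b} \<in> components (C_set g)"

definition N_minus :: "(real \<Rightarrow> real) \<Rightarrow> ereal set" where
  "N_minus g = {a. \<exists>b. C_component g a b} - ereal ` D_set g"

definition N_plus :: "(real \<Rightarrow> real) \<Rightarrow> ereal set" where
  "N_plus g = {b. \<exists>a. C_component g a b} - ereal ` D_set g"

definition g_domain :: "(real \<Rightarrow> real) \<Rightarrow> real set \<Rightarrow> bool" where
  "g_domain g \<Omega> \<longleftrightarrow> open \<Omega> \<and>
     (\<forall>a b. \<forall>x\<in>\<Omega>. C_component g a b \<and> a < ereal x \<and> ereal x < b \<longrightarrow> b \<in> ereal ` \<Omega>)"

definition g_quotient ::
    "(real \<Rightarrow> real) \<Rightarrow> (real \<Rightarrow> 'a::real_normed_field) \<Rightarrow> real \<Rightarrow> real \<Rightarrow> 'a" where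
  "g_quotient g f x y = (f y - f x) / of_real (g y - g x)"

text \<open>
  \<open>has_g_derivative g \<Omega> f d x\<close>: the function \<open>f\<close> on \<open>\<Omega>\<close> has \<open>g\<close>-derivative \<open>d\<close> at \<open>x\<close>.
  As \<open>\<Omega>\<close> is open, the limits only involve the values of \<open>f\<close> on \<open>\<Omega>\<close>. For a derivator,
  the denominators do not vanish on the side(s) from which the limits are taken, and a
  point outside \<open>C_set g\<close> belongs to at most one of \<open>N_plus g\<close> and \<open>N_minus g\<close>.
\<close>

definition has_g_derivative ::
    "(real \<Rightarrow> real) \<Rightarrow> real set \<Rightarrow> (real \<Rightarrow> 'a::real_normed_field) \<Rightarrow> 'a \<Rightarrow> real \<Rightarrow> bool" where
  "has_g_derivative g \<Omega> f d x \<longleftrightarrow> g_domain g \<Omega> \<and> x \<in> \<Omega> \<and>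
     (if x \<in> D_set g then (g_quotient g f x \<longlongrightarrow> d) (at_right x)
      else if x \<in> C_set g then
        (\<exists>a b. C_component g a (ereal b) \<and> a < ereal x \<and> x < b \<and>
               (g_quotient g f b \<longlongrightarrow> d) (at_right b))
      else if ereal x \<in> N_plus g then (g_quotient g f x \<longlongrightarrow> d) (at_right x)
      else if ereal x \<in> N_minus g then (g_quotient g f x \<longlongrightarrow> d) (at_left x)
      else (g_quotient g f x \<longlongrightarrow> d) (at x))"

end

theory Submission
  imports Defs
begin

text \<open>
  The monomial of degree \<open>n\<close> has constant sign on each side of the centre \<open>s\<close>, and its absolute
  value grows away from \<open>s\<close>. The mean value estimate for
  \<open>g\<^sub>n\<^sub>+\<^sub>1(y) - g\<^sub>n\<^sub>+\<^sub>1(x) = (n + 1) \<integral>\<^bsub>[x, y)\<^esub> g\<^sub>n d\<mu>\<close> is therefore controlled by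
  increments of \<open>\<bar>g\<^sub>n\<bar>\<close>, all of the same sign, and can be summed over \<open>n\<close> without exchanging
  limits and integrals: with \<open>E\<close> the exponential series and \<open>M\<close> the sum of the norms of its terms,
  \<open>\<bar>E(y) - E(x) - c E(x) (g(y) - g(x))\<bar> \<le> \<bar>c\<bar> \<bar>M(y) - M(x)\<bar> (g(y) - g(x\<^sup>+))\<close>.
  As \<open>y\<close> decreases to \<open>x\<close>, the last factor is negligible against \<open>g(y) - g(x)\<close> if \<open>x\<close> is a jump,
  and otherwise \<open>M(y) - M(x)\<close> tends to zero, by the same kind of estimate for \<open>M\<close>. Limits from
  the left are similar.
\<close>

section \<open>Recursion for the monomials and the series of norms\<close>

lemma sets_stieltjes_measure [simp, measurable_cong]: "sets (stieltjes_measure g) = sets borel"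
  by (simp add: stieltjes_measure_def)

text \<open>At \<open>x = s\<close> the definition takes the other branch, but there both integrals
  are over the empty set.\<close>

lemma g_monomial_Suc_left:
  "x \<le> s \<Longrightarrow> g_monomial g s (Suc n) x =
     - real (Suc n) * (LINT y:{x..<s}|stieltjes_measure g. g_monomial g s n y)"
  by (cases "x = s") (auto simp: set_lebesgue_integral_def)

lemma g_monomial_center: "g_monomial g s n s = (if n = 0 then 1 else 0)"
  by (cases n) (simp_all add: set_lebesgue_integral_def)

lemma g_monomial_Suc_right:
  "s \<le> x \<Longrightarrow> g_monomial g s (Suc n) x =
     real (Suc n) * (LINT y:{s..<x}|stieltjes_measure g. g_monomial g s n y)"
  by (simp add: g_monomial.simps)

declare g_monomial.simps(2) [simp del]

lemma norm_exp_term: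
  fixes c :: "'a::{real_normed_field,banach}"
  shows "norm (exp_term g c s x n) = norm c ^ n * \<bar>g_monomial g s n x\<bar> / fact n"
  by (simp add: exp_term_def norm_mult norm_divide norm_power)

text \<open>The series \<open>M\<close> of the overview. Its increments serve as error bounds: on
  one side of \<open>s\<close> the increments of all its terms have the same sign.\<close>

definition exp_majorant ::
    "(real \<Rightarrow> real) \<Rightarrow> 'a::{real_normed_field,banach} \<Rightarrow> real \<Rightarrow> real \<Rightarrow> real" where
  "exp_majorant g c s x = (\<Sum>n. norm (exp_term g c s x n))"

lemma exp_majorant_nonneg:
  "x \<in> exp_abs_conv_set g c s \<Longrightarrow> 0 \<le> exp_majorant g c s x"
  by (simp add: exp_majorant_def exp_abs_conv_set_def suminf_nonneg)

lemma exp_majorant_mono: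
  assumes "x \<in> exp_abs_conv_set g c s" "y \<in> exp_abs_conv_set g c s"
    and "\<And>n. \<bar>g_monomial g s n x\<bar> \<le> \<bar>g_monomial g s n y\<bar>"
  shows "exp_majorant g c s x \<le> exp_majorant g c s y"
  unfolding exp_majorant_def
  by (rule suminf_le)
     (use assms in \<open>auto simp: norm_exp_term exp_abs_conv_set_def intro!: divide_right_mono mult_left_mono\<close>)

lemma exp_max_interval_subset: "exp_max_interval g c s \<subseteq> exp_abs_conv_set g c s"
  unfolding exp_max_interval_def by (rule connected_component_subset)

section \<open>Components of the set of local constancy, with extended real end points\<close>

lemma C_component_subset: "C_component g a b \<Longrightarrow> a < ereal x \<Longrightarrow> ereal x < b \<Longrightarrow> x \<in> C_set g"
  unfolding C_component_def by (drule in_components_subset, erule subsetD) simp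

text \<open>Serves to locate end points: a connected set of constancy points that meets a component
  cannot reach past its ends.\<close>

lemma C_component_maximal:
  assumes C: "C_component g a b" and "connected T" "T \<subseteq> C_set g"
    and "a < ereal x" "ereal x < b" "x \<in> T" "y \<in> T"
  shows "a < ereal y \<and> ereal y < b"
proof -
  have "T \<subseteq> {x. a < ereal x \<and> ereal x < b}"
  proof (rule components_maximal[OF C[unfolded C_component_def] assms(2,3)])
    have "x \<in> {x. a < ereal x \<and> ereal x < b} \<inter> T"
      using assms(4-6) by simp
    then show "{x. a < ereal x \<and> ereal x < b} \<inter> T \<noteq> {}"
      by blast
  qed
  then have "y \<in> {x. a < ereal x \<and> ereal x < b}"
    using assms(7) by (rule subsetD)
  then show ?thesis by simp
qed

lemma C_component_point:
  assumes "C_component g a b"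
  obtains p where "a < ereal p" "ereal p < b"
proof -
  have "{x. a < ereal x \<and> ereal x < b} \<noteq> {}"
    using assms unfolding C_component_def by (rule in_components_nonempty)
  then show ?thesis using that by auto
qed

lemma ereal_le_of_dense_right:
  assumes "x < z" and "\<And>w. x < w \<Longrightarrow> w < z \<Longrightarrow> a \<le> ereal w"
  shows "a \<le> ereal x"
proof (rule tendsto_lowerbound)
  show "(ereal \<longlongrightarrow> ereal x) (at_right x)" by (intro tendsto_intros)
  show "\<forall>\<^sub>F w in at_right x. a \<le> ereal w"
    using assms by (auto simp: eventually_at_right_field)
qed simp

lemma ereal_ge_of_dense_left:
  assumes "z < x" and "\<And>w. z < w \<Longrightarrow> w < x \<Longrightarrow> ereal w \<le> b"
  shows "ereal x \<le> b"
proof (rule tendsto_upperbound)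
  show "(ereal \<longlongrightarrow> ereal x) (at_left x)" by (intro tendsto_intros)
  show "\<forall>\<^sub>F w in at_left x. ereal w \<le> b"
    using assms by (auto simp: eventually_at_left_field)
qed simp

section \<open>Right limits, jumps and the mass of intervals\<close>

context
  fixes g :: "real \<Rightarrow> real"
  assumes g: "derivator g"
begin

lemma derivator_mono: "x \<le> y \<Longrightarrow> g x \<le> g y"
  using g by (auto simp: derivator_def mono_def)

lemma derivator_tendsto_left: "(g \<longlongrightarrow> g x) (at_left x)"
  using g by (auto simp: derivator_def continuous_within)

lemma emeasure_stieltjes_Ico_finite: "emeasure (stieltjes_measure g) {a..<b} < \<infinity>"
  by (cases "a \<le> b") (simp_all add: emeasure_stieltjes_measure[OF g])

lemma emeasure_stieltjes_Ioo_finite: "emeasure (stieltjes_measure g) {a<..<b} < \<infinity>"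
  by (rule le_less_trans[OF emeasure_mono emeasure_stieltjes_Ico_finite[of a b]]) auto

lemma measure_stieltjes_Ico: "a \<le> b \<Longrightarrow> measure (stieltjes_measure g) {a..<b} = g b - g a"
  by (simp add: measure_def emeasure_stieltjes_measure[OF g] derivator_mono)

text \<open>\<open>jump\<close> is defined through \<open>Lim\<close>, which is meaningful only once
  a limit is known to exist. By monotonicity the infimum over the right half-line is that
  limit.\<close>

lemma tendsto_at_right_Inf: "(g \<longlongrightarrow> (INF y\<in>{x<..}. g y)) (at_right x)"
proof (rule order_tendstoI)
  have bdd: "bdd_below (g ` {x<..})"
    by (rule bdd_belowI[of _ "g x"]) (auto intro: derivator_mono)
  fix a
  show "\<forall>\<^sub>F y in at_right x. a < g y" if "a < (INF y\<in>{x<..}. g y)"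
    unfolding eventually_at_right_field
    using that cINF_lower[OF bdd] by (intro exI[of _ "x + 1"]) (fastforce intro: less_le_trans)
  assume "(INF y\<in>{x<..}. g y) < a"
  then obtain z where "x < z" "g z < a"
    using cINF_less_iff[OF _ bdd, of a] by auto
  then show "\<forall>\<^sub>F y in at_right x. g y < a"
    unfolding eventually_at_right_field
    by (intro exI[of _ z]) (use derivator_mono le_less_trans less_imp_le in blast)
qed

lemma tendsto_at_right_jump: "(g \<longlongrightarrow> g x + jump g x) (at_right x)"
  using tendsto_at_right_Inf[of x] by (simp add: jump_def tendsto_Lim)

lemma right_limit_le:
  assumes "x < y"
  shows "g x + jump g x \<le> g y"
  by (rule tendsto_upperbound[OF tendsto_at_right_jump])
     (use assms in \<open>auto simp: eventually_at_right_field intro!: exI[of _ y] derivator_mono\<close>)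

lemma jump_nonneg: "0 \<le> jump g x"
proof -
  have "g x \<le> g x + jump g x"
    by (rule tendsto_lowerbound[OF tendsto_at_right_jump])
      (auto simp: eventually_at_right_field intro!: exI[of _ "x+1"] derivator_mono)
  then show ?thesis by simp
qed

text \<open>The open interval is exhausted by half-open intervals starting at
  \<open>x + 1 / (i + 1)\<close>. Each has mass at most \<open>g y\<close> minus the right limit of
  \<open>g\<close> at \<open>x\<close>, and the bound survives the limit.\<close>

lemma measure_stieltjes_Ioo_le:
  assumes "x < y"
  shows "measure (stieltjes_measure g) {x<..<y} \<le> g y - (g x + jump g x)"
proof -
  let ?a = "\<lambda>i. x + 1 / real (Suc i)"
  have Un: "(\<Union>i. {?a i..<y}) = {x<..<y}"
  proof safe
    fix z assume "z \<in> {x<..<y}"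
    then obtain i where "1 / real (Suc i) < z - x"
      using nat_approx_posE[of "z - x"] by auto
    then show "z \<in> (\<Union>i. {?a i..<y})"
      using \<open>z \<in> _\<close> by (auto intro!: exI[of _ i])
  next
    fix z i assume "z \<in> {?a i..<y}"
    moreover have "x < ?a i" by simp
    ultimately show "z \<in> {x<..<y}"
      by (metis atLeastLessThan_iff greaterThanLessThan_iff less_le_trans)
  qed
  have "(\<lambda>i. measure (stieltjes_measure g) {?a i..<y}) \<longlonglongrightarrow>
        measure (stieltjes_measure g) (\<Union>i. {?a i..<y})"
  proof (rule Lim_measure_incseq)
    have "?a j \<le> ?a i" if "i \<le> j" for i j
      using that by (simp add: frac_le)
    then show "incseq (\<lambda>i. {?a i..<y})"
      by (fastforce simp: incseq_def)
    show "emeasure (stieltjes_measure g) (\<Union>i. {?a i..<y}) \<noteq> \<infinity>"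
      unfolding Un using emeasure_stieltjes_Ioo_finite[of x y] by simp
  qed auto
  moreover have "measure (stieltjes_measure g) {?a i..<y} \<le> g y - (g x + jump g x)" for i
  proof (cases "?a i \<le> y")
    case True
    then show ?thesis
      using right_limit_le[of x "?a i"] by (simp add: measure_stieltjes_Ico)
  next
    \<comment> \<open>Here the approximating interval is empty, and the bound is
      nonnegative.\<close>
    case False
    then show ?thesis using right_limit_le[OF assms] by simp
  qed
  ultimately show ?thesis
    unfolding Un by (intro LIMSEQ_le_const2) auto
qed

section \<open>Integrals over half-open intervals; sign and monotonicity of the monomials\<close>

lemma set_integrable_stieltjes_Ico:
  fixes f :: "real \<Rightarrow> real"
  assumes "f \<in> borel_measurable borel" and "\<And>t. t \<in> {a..<b} \<Longrightarrow> \<bar>f t\<bar> \<le> B"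
  shows "set_integrable (stieltjes_measure g) {a..<b} f"
  unfolding set_integrable_def
  by (rule integrableI_bounded_set_indicator[where B = B])
     (use assms emeasure_stieltjes_Ico_finite in \<open>auto intro!: AE_I2\<close>)

lemma set_lebesgue_integral_Ico_split:
  fixes f :: "real \<Rightarrow> real"
  assumes "set_integrable (stieltjes_measure g) {a..<c} f" and "a \<le> b" "b \<le> c"
  shows "(LINT t:{a..<c}|stieltjes_measure g. f t) =
         (LINT t:{a..<b}|stieltjes_measure g. f t) + (LINT t:{b..<c}|stieltjes_measure g. f t)"
proof -
  have "{a..<c} = {a..<b} \<union> {b..<c}"
    using assms by auto
  then show ?thesis
    using assms by (auto intro!: set_integral_Un intro: set_integrable_subset)
qed

lemma set_lebesgue_integral_stieltjes_le:
  fixes f :: "real \<Rightarrow> real"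
  assumes "set_integrable (stieltjes_measure g) A f" and "A \<in> sets borel"
    and "emeasure (stieltjes_measure g) A < \<infinity>" and "\<And>t. t \<in> A \<Longrightarrow> \<bar>f t\<bar> \<le> B"
  shows "\<bar>LINT t:A|stieltjes_measure g. f t\<bar> \<le> B * measure (stieltjes_measure g) A"
proof -
  let ?\<mu> = "stieltjes_measure g"
  have c: "set_integrable ?\<mu> A (\<lambda>_. d)" for d :: real
    using assms(2,3) by (simp add: set_integrable_def)
  have i: "(LINT t:A|?\<mu>. d) = d * measure ?\<mu> A" for d :: real
    using assms(2,3) by (subst set_integral_const) (auto simp: mult.commute)
  have "(LINT t:A|?\<mu>. f t) \<le> (LINT t:A|?\<mu>. B)"
    by (rule set_integral_mono[OF assms(1) c]) (use assms(4) in force)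
  moreover have "(LINT t:A|?\<mu>. - B) \<le> (LINT t:A|?\<mu>. f t)"
    by (rule set_integral_mono[OF c assms(1)]) (use assms(4) in force)
  ultimately show ?thesis
    unfolding i by simp
qed

text \<open>The three properties need a joint induction: measurability and monotonicity make the
  monomial of degree \<open>n\<close> integrable, its sign makes the next one monotone, and
  monotonicity makes that one measurable. To the left of \<open>s\<close> the signs alternate with
  the degree, which the factor \<open>(-1) ^ n\<close> compensates.\<close>

lemma g_monomial_measurable_monotone:
  "g_monomial g s n \<in> borel_measurable borel \<and>
   (\<forall>x y. s \<le> x \<longrightarrow> x \<le> y \<longrightarrow> 0 \<le> g_monomial g s n x \<and> g_monomial g s n x \<le> g_monomial g s n y) \<and>
   (\<forall>x y. x \<le> y \<longrightarrow> y \<le> s \<longrightarrow> 0 \<le> (-1) ^ n * g_monomial g s n y \<and>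
      (-1) ^ n * g_monomial g s n y \<le> (-1) ^ n * g_monomial g s n x)"
proof (induction n)
  case 0
  show ?case by simp
next
  case (Suc n)
  let ?\<mu> = "stieltjes_measure g" and ?f = "g_monomial g s n" and ?F = "g_monomial g s (Suc n)"
  have meas: "?f \<in> borel_measurable borel"
    and nonneg: "0 \<le> ?f x" and mono: "x \<le> y \<Longrightarrow> ?f x \<le> ?f y" if "s \<le> x" for x y
    using Suc that by auto
  have nonneg': "0 \<le> (-1) ^ n * ?f y" and anti: "x \<le> y \<Longrightarrow> (-1) ^ n * ?f y \<le> (-1) ^ n * ?f x"
    if "y \<le> s" for x y
    using Suc that by auto
  have abs: "\<bar>?f y\<bar> = (-1) ^ n * ?f y" if "y \<le> s" for y
    using abs_of_nonneg[OF nonneg'[OF that]] by (simp add: abs_mult power_abs)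
  \<comment> \<open>Monotonicity bounds the integrand by its value at the end point farther from
    \<open>s\<close>; on the left this is \<open>x\<close>.\<close>
  have int: "set_integrable ?\<mu> {x..<y} ?f" if "s \<le> x" for x y
    by (rule set_integrable_stieltjes_Ico[where B = "?f y"])
       (use that meas nonneg mono in force)+
  have int': "set_integrable ?\<mu> {x..<y} ?f" if "y \<le> s" for x y
    by (rule set_integrable_stieltjes_Ico[where B = "(-1) ^ n * ?f x"])
       (use that meas anti abs in auto)
  have R: "0 \<le> ?F x \<and> ?F x \<le> ?F y" if "s \<le> x" "x \<le> y" for x y
  proof -
    have "0 \<le> (LINT t:{a..<b}|?\<mu>. ?f t)" if "s \<le> a" for a b
      unfolding set_lebesgue_integral_def
      by (rule integral_nonneg_AE) (use that nonneg in \<open>auto simp: indicator_def\<close>)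
    from this[of s x] this[of x y] set_lebesgue_integral_Ico_split[OF int, where a = s and b = x and c = y] show ?thesis
      using that by (simp add: g_monomial_Suc_right mult_left_mono)
  qed
  have L: "0 \<le> (-1) ^ Suc n * ?F y \<and> (-1) ^ Suc n * ?F y \<le> (-1) ^ Suc n * ?F x"
    if "x \<le> y" "y \<le> s" for x y
  proof -
    have "0 \<le> (LINT t:{a..<b}|?\<mu>. (-1) ^ n * ?f t)" if "b \<le> s" for a b
      unfolding set_lebesgue_integral_def
      by (rule integral_nonneg_AE) (use that nonneg' in \<open>auto simp: indicator_def\<close>)
    then have *: "0 \<le> (-1) ^ n * (LINT t:{a..<b}|?\<mu>. ?f t)" if "b \<le> s" for a b
      using that by simp
    \<comment> \<open>The minus sign of the left recursion is absorbed by the change from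
      \<open>(-1) ^ Suc n\<close> to \<open>(-1) ^ n\<close>.\<close>
    have **: "(-1) ^ Suc n * ?F z = real (Suc n) * ((-1) ^ n * (LINT t:{z..<s}|?\<mu>. ?f t))"
      if "z \<le> s" for z
      using that by (simp add: g_monomial_Suc_left algebra_simps)
    show ?thesis
      using *[of y x] *[of s y] set_lebesgue_integral_Ico_split[OF int', where a = x and b = y and c = s] that
      unfolding **[OF that(2)] **[OF order_trans[OF that]]
      by (simp add: mult_left_mono distrib_left)
  qed
  \<comment> \<open>Measurability is obtained on each side of \<open>s\<close> from monotonicity, up
    to sign on the left. The conditional with equal branches below glues the two halves
    together.\<close>
  have "?F \<in> borel_measurable (restrict_space borel {s..})"
    by (rule borel_measurable_mono_on_fnc) (use R in \<open>auto simp: mono_on_def\<close>)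
  moreover have "(\<lambda>x. - ((-1) ^ Suc n * ?F x)) \<in> borel_measurable (restrict_space borel {..<s})"
    by (rule borel_measurable_mono_on_fnc) (use L in \<open>auto simp: mono_on_def\<close>)
  then have "(\<lambda>x. (-1) ^ n * ?F x) \<in> borel_measurable (restrict_space borel {..<s})"
    by simp
  then have "(\<lambda>x. (-1) ^ n * ((-1) ^ n * ?F x)) \<in> borel_measurable (restrict_space borel {..<s})"
    by (rule borel_measurable_times[OF borel_measurable_const])
  then have "?F \<in> borel_measurable (restrict_space borel {..<s})"
    by (cases "even n") simp_all
  ultimately have "(\<lambda>x. if s \<le> x then ?F x else ?F x) \<in> borel_measurable borel"
    by (subst measurable_If_restrict_space_iff) (auto simp: atLeast_def lessThan_def not_le)
  then show ?case
    using R L by simp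
qed

lemma borel_measurable_g_monomial: "g_monomial g s n \<in> borel_measurable borel"
  using g_monomial_measurable_monotone by blast

lemma g_monomial_abs_mono:
  "s \<le> x \<Longrightarrow> x \<le> y \<Longrightarrow> \<bar>g_monomial g s n x\<bar> \<le> \<bar>g_monomial g s n y\<bar>"
  using g_monomial_measurable_monotone[of s n] by force

text \<open>Splitting by parity removes the factor \<open>(-1) ^ n\<close>, so that linear
  arithmetic can handle absolute values.\<close>

lemma g_monomial_left_cases:
  assumes "x \<le> y" and "y \<le> s"
  shows "0 \<le> g_monomial g s n y \<and> g_monomial g s n y \<le> g_monomial g s n x \<and> even n \<or>
         g_monomial g s n y \<le> 0 \<and> g_monomial g s n x \<le> g_monomial g s n y \<and> odd n"
proof -
  have "0 \<le> (-1) ^ n * g_monomial g s n y"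
    "(-1) ^ n * g_monomial g s n y \<le> (-1) ^ n * g_monomial g s n x"
    using assms g_monomial_measurable_monotone[of s n] by auto
  then show ?thesis
    by (cases "even n") auto
qed

lemma g_monomial_abs_antimono:
  "x \<le> y \<Longrightarrow> y \<le> s \<Longrightarrow> \<bar>g_monomial g s n y\<bar> \<le> \<bar>g_monomial g s n x\<bar>"
  using g_monomial_left_cases[of x y s n] by linarith

text \<open>The hypothesis \<open>side\<close> keeps \<open>[x, y]\<close> on one side of
  \<open>s\<close>. There the monomial is monotone of constant sign, so its oscillation is the
  change of its absolute value. The bounds are symmetric in the end points because which of them is
  farther from \<open>s\<close> depends on the side.\<close>

lemma g_monomial_between:
  assumes "x \<le> z" "z \<le> y" and side: "s \<le> x \<or> y \<le> s"
  shows "\<bar>g_monomial g s n z - g_monomial g s n x\<bar> \<le> \<bar>\<bar>g_monomial g s n y\<bar> - \<bar>g_monomial g s n x\<bar>\<bar>"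
    and "\<bar>g_monomial g s n z - g_monomial g s n y\<bar> \<le> \<bar>\<bar>g_monomial g s n y\<bar> - \<bar>g_monomial g s n x\<bar>\<bar>"
    and "\<bar>g_monomial g s n z\<bar> \<le> \<bar>g_monomial g s n x\<bar> + \<bar>g_monomial g s n y\<bar>"
proof -
  \<comment> \<open>The cases are: right of \<open>s\<close>, left of \<open>s\<close> with
    \<open>n\<close> even, left of \<open>s\<close> with \<open>n\<close> odd.\<close>
  consider "0 \<le> g_monomial g s n x" "g_monomial g s n x \<le> g_monomial g s n z"
      "g_monomial g s n z \<le> g_monomial g s n y"
    | "0 \<le> g_monomial g s n y" "g_monomial g s n y \<le> g_monomial g s n z"
      "g_monomial g s n z \<le> g_monomial g s n x"
    | "g_monomial g s n y \<le> 0" "g_monomial g s n z \<le> g_monomial g s n y"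
      "g_monomial g s n x \<le> g_monomial g s n z"
  proof (cases "s \<le> x")
    case True
    then show ?thesis
      using assms g_monomial_measurable_monotone[of s n] that(1) by auto
  next
    case False
    then show ?thesis
      using assms g_monomial_left_cases[of x z s n] g_monomial_left_cases[of z y s n] that(2,3)
      by auto
  qed
  then have "\<bar>g_monomial g s n z - g_monomial g s n x\<bar> \<le> \<bar>\<bar>g_monomial g s n y\<bar> - \<bar>g_monomial g s n x\<bar>\<bar> \<and>
    \<bar>g_monomial g s n z - g_monomial g s n y\<bar> \<le> \<bar>\<bar>g_monomial g s n y\<bar> - \<bar>g_monomial g s n x\<bar>\<bar> \<and>
    \<bar>g_monomial g s n z\<bar> \<le> \<bar>g_monomial g s n x\<bar> + \<bar>g_monomial g s n y\<bar>"
    by cases linarith+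
  then show "\<bar>g_monomial g s n z - g_monomial g s n x\<bar> \<le> \<bar>\<bar>g_monomial g s n y\<bar> - \<bar>g_monomial g s n x\<bar>\<bar>"
    and "\<bar>g_monomial g s n z - g_monomial g s n y\<bar> \<le> \<bar>\<bar>g_monomial g s n y\<bar> - \<bar>g_monomial g s n x\<bar>\<bar>"
    and "\<bar>g_monomial g s n z\<bar> \<le> \<bar>g_monomial g s n x\<bar> + \<bar>g_monomial g s n y\<bar>"
    by simp_all
qed

lemma g_monomial_integrable:
  assumes "s \<le> x \<or> y \<le> s"
  shows "set_integrable (stieltjes_measure g) {x..<y} (g_monomial g s n)"
  by (rule set_integrable_stieltjes_Ico[where B = "\<bar>g_monomial g s n x\<bar> + \<bar>g_monomial g s n y\<bar>"])
     (use assms g_monomial_between(3) borel_measurable_g_monomial in auto)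

section \<open>Increments of the monomials\<close>

lemma g_monomial_Suc_diff:
  assumes "x \<le> y" and side: "s \<le> x \<or> y \<le> s"
  shows "g_monomial g s (Suc n) y - g_monomial g s (Suc n) x =
         real (Suc n) * (LINT t:{x..<y}|stieltjes_measure g. g_monomial g s n t)"
proof (cases "s \<le> x")
  case True
  then show ?thesis
    using set_lebesgue_integral_Ico_split[OF g_monomial_integrable, where a = s and b = x and c = y] assms
    by (simp add: g_monomial_Suc_right algebra_simps)
next
  case False
  then show ?thesis
    using set_lebesgue_integral_Ico_split[OF g_monomial_integrable, where a = x and b = y and c = s] assms
    by (simp add: g_monomial_Suc_left algebra_simps)
qed

text \<open>Since \<open>[x, y)\<close> has mass \<open>g y - g x\<close>, the error of a linear
  approximation is the integral of the deviation from \<open>r\<close>. Below, \<open>r\<close> is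
  the value of the monomial at an end point.\<close>

lemma g_monomial_Suc_increment:
  assumes "x \<le> y" and side: "s \<le> x \<or> y \<le> s"
  shows "g_monomial g s (Suc n) y - g_monomial g s (Suc n) x - real (Suc n) * (r * (g y - g x)) =
         real (Suc n) * (LINT t:{x..<y}|stieltjes_measure g. g_monomial g s n t - r)"
    and "set_integrable (stieltjes_measure g) {x..<y} (\<lambda>t. g_monomial g s n t - r)"
proof -
  let ?\<mu> = "stieltjes_measure g"
  have c: "set_integrable ?\<mu> {x..<y} (\<lambda>_. r)"
    using emeasure_stieltjes_Ico_finite by (simp add: set_integrable_def)
  have "(LINT t:{x..<y}|?\<mu>. r) = r * (g y - g x)"
    using emeasure_stieltjes_Ico_finite[of x y] assms(1)
    by (subst set_integral_const) (auto simp: measure_stieltjes_Ico)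
  then show "g_monomial g s (Suc n) y - g_monomial g s (Suc n) x - real (Suc n) * (r * (g y - g x)) =
         real (Suc n) * (LINT t:{x..<y}|?\<mu>. g_monomial g s n t - r)"
    using set_integral_diff(2)[OF g_monomial_integrable[OF side, of n] c]
      g_monomial_Suc_diff[OF assms, of n] by (simp only: right_diff_distrib)
  show "set_integrable ?\<mu> {x..<y} (\<lambda>t. g_monomial g s n t - r)"
    by (rule set_integral_diff(1)[OF g_monomial_integrable[OF side] c])
qed

text \<open>Expansion about the right end point, for limits from the left. The full mass of
  \<open>[x, y)\<close> suffices in the bound, because it tends to zero as \<open>x\<close>
  increases to \<open>y\<close>.\<close>

lemma g_monomial_left_estimate:
  assumes "x \<le> y" and side: "s \<le> x \<or> y \<le> s"
  shows "\<bar>g_monomial g s (Suc n) y - g_monomial g s (Suc n) x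
            - real (Suc n) * (g_monomial g s n y * (g y - g x))\<bar>
         \<le> real (Suc n) * (\<bar>\<bar>g_monomial g s n y\<bar> - \<bar>g_monomial g s n x\<bar>\<bar> * (g y - g x))"
  unfolding g_monomial_Suc_increment(1)[OF assms] abs_mult abs_of_nat
  using set_lebesgue_integral_stieltjes_le[OF g_monomial_Suc_increment(2)[OF assms]
      _ emeasure_stieltjes_Ico_finite g_monomial_between(2)[OF _ _ side]]
  by (intro mult_left_mono) (auto simp: measure_stieltjes_Ico assms(1))

text \<open>At \<open>t = x\<close> the integrand \<open>g_monomial g s n t - g_monomial g s n x\<close> vanishes, so the atom
  at \<open>x\<close> does not contribute and the jump can be subtracted from the mass of \<open>[x, y)\<close>.\<close>

lemma g_monomial_right_estimate:
  assumes "x < y" and side: "s \<le> x \<or> y \<le> s"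
  shows "\<bar>g_monomial g s (Suc n) y - g_monomial g s (Suc n) x
            - real (Suc n) * (g_monomial g s n x * (g y - g x))\<bar>
         \<le> real (Suc n) * (\<bar>\<bar>g_monomial g s n y\<bar> - \<bar>g_monomial g s n x\<bar>\<bar> * (g y - g x - jump g x))"
proof -
  let ?\<mu> = "stieltjes_measure g"
  let ?f = "\<lambda>t. g_monomial g s n t - g_monomial g s n x"
  have le: "x \<le> y" using assms by simp
  have int: "set_integrable ?\<mu> {x<..<y} ?f"
    by (rule set_integrable_subset[OF g_monomial_Suc_increment(2)[OF le side]]) auto
  have eq: "(LINT t:{x..<y}|?\<mu>. ?f t) = (LINT t:{x<..<y}|?\<mu>. ?f t)"
    unfolding set_lebesgue_integral_def
    by (rule Bochner_Integration.integral_cong) (auto simp: indicator_def)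
  have "\<bar>LINT t:{x<..<y}|?\<mu>. ?f t\<bar>
      \<le> \<bar>\<bar>g_monomial g s n y\<bar> - \<bar>g_monomial g s n x\<bar>\<bar> * measure ?\<mu> {x<..<y}"
    by (rule set_lebesgue_integral_stieltjes_le[OF int _ emeasure_stieltjes_Ioo_finite
          g_monomial_between(1)[OF _ _ side]]) auto
  also have "\<dots> \<le> \<bar>\<bar>g_monomial g s n y\<bar> - \<bar>g_monomial g s n x\<bar>\<bar> * (g y - g x - jump g x)"
    using measure_stieltjes_Ioo_le[OF assms(1)] by (intro mult_left_mono) auto
  finally show ?thesis
    unfolding g_monomial_Suc_increment(1)[OF le side] eq abs_mult abs_of_nat
    by (intro mult_left_mono) auto
qed

lemma g_monomial_abs_increment:
  assumes "x \<le> y" and side: "s \<le> x \<or> y \<le> s"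
  shows "\<bar>\<bar>g_monomial g s (Suc n) y\<bar> - \<bar>g_monomial g s (Suc n) x\<bar>\<bar>
         \<le> real (Suc n) * ((\<bar>g_monomial g s n x\<bar> + \<bar>g_monomial g s n y\<bar>) * (g y - g x))"
proof -
  have "\<bar>g_monomial g s (Suc n) y - g_monomial g s (Suc n) x\<bar>
      \<le> real (Suc n) * ((\<bar>g_monomial g s n x\<bar> + \<bar>g_monomial g s n y\<bar>) * (g y - g x))"
    unfolding g_monomial_Suc_diff[OF assms] abs_mult abs_of_nat
    using set_lebesgue_integral_stieltjes_le[OF g_monomial_integrable[OF side]
        _ emeasure_stieltjes_Ico_finite g_monomial_between(3)[OF _ _ side]]
    by (intro mult_left_mono) (auto simp: measure_stieltjes_Ico assms(1))
  then show ?thesis by linarith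
qed

section \<open>Increments of the exponential series and of its majorant\<close>

lemma exp_majorant_between:
  assumes "x \<in> exp_abs_conv_set g c s" "y \<in> exp_abs_conv_set g c s" "z \<in> exp_abs_conv_set g c s"
    and "x \<le> z" "z \<le> y" and side: "s \<le> x \<or> y \<le> s"
  shows "exp_majorant g c s z \<le> exp_majorant g c s x + exp_majorant g c s y"
proof (cases "s \<le> x")
  case True
  then have "exp_majorant g c s z \<le> exp_majorant g c s y"
    using assms by (intro exp_majorant_mono g_monomial_abs_mono) auto
  then show ?thesis using exp_majorant_nonneg[OF assms(1)] by simp
next
  case False
  then have "exp_majorant g c s z \<le> exp_majorant g c s x"
    using assms by (intro exp_majorant_mono g_monomial_abs_antimono) auto
  then show ?thesis using exp_majorant_nonneg[OF assms(2)] by simp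
qed

text \<open>The change of the term of index \<open>n + 1\<close> is controlled by the terms of index
  \<open>n\<close>, the factor \<open>n + 1\<close> cancelling against the factorial. Hence
  \<open>exp_majorant\<close> has no jump where \<open>g\<close> has none.\<close>

lemma exp_majorant_diff:
  assumes x: "x \<in> exp_abs_conv_set g c s" and y: "y \<in> exp_abs_conv_set g c s"
    and le: "x \<le> y" and side: "s \<le> x \<or> y \<le> s"
  shows "\<bar>exp_majorant g c s y - exp_majorant g c s x\<bar>
         \<le> norm c * (exp_majorant g c s x + exp_majorant g c s y) * (g y - g x)"
proof -
  let ?t = "\<lambda>z n. norm (exp_term g c s z n)"
  have sx: "?t x sums exp_majorant g c s x" and sy: "?t y sums exp_majorant g c s y"
    using x y by (simp_all add: exp_majorant_def exp_abs_conv_set_def summable_sums)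
  \<comment> \<open>The term of index 0 is constantly 1 and drops out of the difference, so both
    series may start at index 1.\<close>
  have "(\<lambda>n. ?t z (Suc n)) sums (exp_majorant g c s z - 1)" if "?t z sums exp_majorant g c s z" for z
    using that by (subst sums_Suc_iff) (simp add: exp_term_def)
  from sums_diff[OF this[OF sy] this[OF sx]]
  have d: "(\<lambda>n. ?t y (Suc n) - ?t x (Suc n)) sums (exp_majorant g c s y - exp_majorant g c s x)"
    by simp
  have b: "(\<lambda>n. norm c * (?t x n + ?t y n) * (g y - g x)) sums
           (norm c * (exp_majorant g c s x + exp_majorant g c s y) * (g y - g x))"
    by (intro sums_mult sums_mult2 sums_add sx sy)
  have "norm (?t y (Suc n) - ?t x (Suc n)) \<le> norm c * (?t x n + ?t y n) * (g y - g x)" for n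
  proof -
    have "norm (?t y (Suc n) - ?t x (Suc n)) =
        norm c ^ Suc n / fact (Suc n) * \<bar>\<bar>g_monomial g s (Suc n) y\<bar> - \<bar>g_monomial g s (Suc n) x\<bar>\<bar>"
      unfolding norm_exp_term
      by (simp add: abs_mult flip: right_diff_distrib diff_divide_distrib del: power_Suc fact_Suc)
    also have "\<dots> \<le> norm c ^ Suc n / fact (Suc n) *
        (real (Suc n) * ((\<bar>g_monomial g s n x\<bar> + \<bar>g_monomial g s n y\<bar>) * (g y - g x)))"
      by (intro mult_left_mono g_monomial_abs_increment le side) simp
    also have "\<dots> = norm c * (?t x n + ?t y n) * (g y - g x)"
      unfolding norm_exp_term by (simp add: field_simps del: of_nat_Suc)
    finally show ?thesis .
  qed
  from norm_suminf_le[OF this sums_summable[OF b]] show ?thesis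
    using d b by (simp add: sums_iff)
qed

text \<open>Common summation step for both one-sided estimates: \<open>w\<close> is the end point
  about which the series is expanded, \<open>d\<close> the increment of \<open>g\<close>, and
  \<open>\<kappa>\<close> the mass left in the error bound, with or without the jump
  removed.\<close>

lemma exp_g_increment:
  fixes c :: "'a::{real_normed_field,banach}"
  assumes x: "x \<in> exp_abs_conv_set g c s" and y: "y \<in> exp_abs_conv_set g c s"
    and w: "w \<in> exp_abs_conv_set g c s"
    and le: "x \<le> y" and side: "s \<le> x \<or> y \<le> s" and "0 \<le> \<kappa>"
    and bound: "\<And>n. \<bar>g_monomial g s (Suc n) y - g_monomial g s (Suc n) x
            - real (Suc n) * (g_monomial g s n w * d)\<bar>
         \<le> real (Suc n) * (\<bar>\<bar>g_monomial g s n y\<bar> - \<bar>g_monomial g s n x\<bar>\<bar> * \<kappa>)"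
  shows "norm (exp_g g c s y - exp_g g c s x - c * exp_g g c s w * of_real d)
         \<le> norm c * \<bar>exp_majorant g c s y - exp_majorant g c s x\<bar> * \<kappa>"
proof -
  let ?t = "exp_term g c s" and ?G = "g_monomial g s"
  \<comment> \<open>The sign is 1 to the right of \<open>s\<close> and -1 to the left. As it is the
    same for all \<open>n\<close>, it factors out of the series and the error bounds add up to a
    difference of majorants.\<close>
  obtain \<sigma> :: real where sgn: "\<And>n. \<bar>\<bar>?G n y\<bar> - \<bar>?G n x\<bar>\<bar> = \<sigma> * (\<bar>?G n y\<bar> - \<bar>?G n x\<bar>)"
    and \<sigma>: "\<bar>\<sigma>\<bar> = 1"
  proof (cases "s \<le> x")
    case True
    then show ?thesis using that[of 1] g_monomial_abs_mono[OF _ le] by simp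
  next
    case False
    then show ?thesis using that[of "-1"] g_monomial_abs_antimono[OF le] side by simp
  qed
  have sums: "?t z sums exp_g g c s z" if "z \<in> exp_abs_conv_set g c s" for z
    using that summable_norm_cancel
    by (auto simp: exp_g_def exp_abs_conv_set_def intro!: summable_sums)
  have "(\<lambda>n. ?t z (Suc n)) sums (exp_g g c s z - 1)" if "z \<in> exp_abs_conv_set g c s" for z
    using sums[OF that] by (subst sums_Suc_iff) (simp add: exp_term_def)
  from sums_diff[OF sums_diff[OF this[OF y] this[OF x]] sums_mult2[OF sums_mult[OF sums[OF w], of c], of "of_real d"]]
  have d: "(\<lambda>n. ?t y (Suc n) - ?t x (Suc n) - c * ?t w n * of_real d) sums
      (exp_g g c s y - exp_g g c s x - c * exp_g g c s w * of_real d)"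
    by simp
  have "(\<lambda>n. norm (?t z n)) sums exp_majorant g c s z" if "z \<in> exp_abs_conv_set g c s" for z
    using that by (simp add: exp_majorant_def exp_abs_conv_set_def summable_sums)
  from sums_mult2[OF sums_mult[OF sums_diff[OF this[OF y] this[OF x]]]]
  have b: "(\<lambda>n. norm c * \<sigma> * (norm (?t y n) - norm (?t x n)) * \<kappa>) sums
           (norm c * \<sigma> * (exp_majorant g c s y - exp_majorant g c s x) * \<kappa>)" .
  have "norm (?t y (Suc n) - ?t x (Suc n) - c * ?t w n * of_real d)
      \<le> norm c * \<sigma> * (norm (?t y n) - norm (?t x n)) * \<kappa>" for n
  proof -
    \<comment> \<open>Multiplying the term of index \<open>n\<close> by \<open>c\<close> gives it
      the common coefficient \<open>c ^ Suc n / fact (Suc n)\<close>, at the price of the factor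
      \<open>n + 1\<close> that occurs in \<open>bound\<close>.\<close>
    have "?t y (Suc n) - ?t x (Suc n) - c * ?t w n * of_real d =
        c ^ Suc n / fact (Suc n) * of_real (?G (Suc n) y - ?G (Suc n) x - real (Suc n) * (?G n w * d))"
      unfolding exp_term_def
      by (simp add: field_simps del: of_nat_Suc)
    then have "norm (?t y (Suc n) - ?t x (Suc n) - c * ?t w n * of_real d) =
        norm c ^ Suc n / fact (Suc n) * \<bar>?G (Suc n) y - ?G (Suc n) x - real (Suc n) * (?G n w * d)\<bar>"
      by (simp only: norm_mult norm_divide norm_power norm_of_real norm_fact)
    also have "\<dots> \<le> norm c ^ Suc n / fact (Suc n) *
        (real (Suc n) * (\<bar>\<bar>?G n y\<bar> - \<bar>?G n x\<bar>\<bar> * \<kappa>))"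
      by (intro mult_left_mono bound) simp
    also have "\<dots> = norm c * \<sigma> * (norm (?t y n) - norm (?t x n)) * \<kappa>"
      unfolding norm_exp_term sgn by (simp add: field_simps del: of_nat_Suc)
    finally show ?thesis .
  qed
  from norm_suminf_le[OF this sums_summable[OF b]]
  have "norm (exp_g g c s y - exp_g g c s x - c * exp_g g c s w * of_real d)
      \<le> norm c * \<sigma> * (exp_majorant g c s y - exp_majorant g c s x) * \<kappa>"
    using d b by (simp add: sums_iff)
  also have "\<dots> = norm c * (\<sigma> * (exp_majorant g c s y - exp_majorant g c s x)) * \<kappa>"
    by (simp only: mult.assoc)
  also have "\<dots> \<le> norm c * \<bar>exp_majorant g c s y - exp_majorant g c s x\<bar> * \<kappa>"
  proof -
    have "\<sigma> * (exp_majorant g c s y - exp_majorant g c s x) \<le> \<bar>exp_majorant g c s y - exp_majorant g c s x\<bar>"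
      using \<sigma> abs_ge_self[of "\<sigma> * (exp_majorant g c s y - exp_majorant g c s x)"] by (simp add: abs_mult)
    then show ?thesis
      using \<open>0 \<le> \<kappa>\<close> by (intro mult_left_mono mult_right_mono) auto
  qed
  finally show ?thesis .
qed

section \<open>One-sided limits of the difference quotients\<close>

lemma g_quotient_exp_right:
  fixes c :: "'a::{real_normed_field,banach}"
  assumes conv: "{l<..} \<subseteq> exp_abs_conv_set g c s" and "l < x"
    and inc: "\<And>y. x < y \<Longrightarrow> g x < g y"
  shows "(g_quotient g (exp_g g c s) x \<longlongrightarrow> c * exp_g g c s x) (at_right x)"
proof -
  let ?M = "exp_majorant g c s" and ?E = "exp_g g c s"
  \<comment> \<open>The interval from \<open>x\<close> to \<open>u\<close> stays on one side of
    \<open>s\<close>, and \<open>K\<close> bounds the sum of the majorants at \<open>x\<close> and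
    \<open>y\<close> for all \<open>y\<close> in it.\<close>
  define u where "u = (if s \<le> x then x + 1 else s)"
  define K where "K = ?M x + (?M x + ?M u)"
  have u: "x < u" "s \<le> x \<or> u \<le> s" by (auto simp: u_def)
  have cv: "y \<in> exp_abs_conv_set g c s" if "x \<le> y" for y
    using conv that \<open>l < x\<close> by auto
  have est: "norm (g_quotient g ?E x y - c * ?E x)
      \<le> norm c * \<bar>?M y - ?M x\<bar> * ((g y - g x - jump g x) / (g y - g x))"
    and K: "?M x + ?M y \<le> K" and side: "s \<le> x \<or> y \<le> s"
    if "x < y" "y < u" for y
  proof -
    show side: "s \<le> x \<or> y \<le> s" using that u by auto
    have pos: "0 < g y - g x" using inc that by simp
    then have nz: "of_real (g y - g x) \<noteq> (0::'a)" by simp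
    have "norm (?E y - ?E x - c * ?E x * of_real (g y - g x))
        \<le> norm c * \<bar>?M y - ?M x\<bar> * (g y - g x - jump g x)"
      using that side right_limit_le[of x y] g_monomial_right_estimate[of x y s]
      by (intro exp_g_increment cv) auto
    moreover have "g_quotient g ?E x y - c * ?E x =
        (?E y - ?E x - c * ?E x * of_real (g y - g x)) / of_real (g y - g x)"
      using nz by (simp add: g_quotient_def diff_divide_distrib)
    ultimately show "norm (g_quotient g ?E x y - c * ?E x)
      \<le> norm c * \<bar>?M y - ?M x\<bar> * ((g y - g x - jump g x) / (g y - g x))"
      using pos by (simp add: norm_divide divide_right_mono del: of_real_diff)
    show "?M x + ?M y \<le> K"
      unfolding K_def using that u by (intro add_left_mono exp_majorant_between cv) auto
  qed
  have ev: "\<forall>\<^sub>F y in at_right x. x < y \<and> y < u"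
    using u by (auto simp: eventually_at_right_field)
  have nn: "0 \<le> ?M y" if "x \<le> y" for y
    using exp_majorant_nonneg cv[OF that] .
  have lim: "((\<lambda>y. g y - g x - jump g x) \<longlongrightarrow> 0) (at_right x)"
    using tendsto_diff[OF tendsto_at_right_jump[of x] tendsto_const[of "g x + jump g x"]]
    by (simp add: algebra_simps)
  have "((\<lambda>y. g_quotient g ?E x y - c * ?E x) \<longlongrightarrow> 0) (at_right x)"
  proof (cases "jump g x = 0")
    \<comment> \<open>Without a jump the mass ratio is 1, and the change of the majorant is at most
      a constant times \<open>g y - g x\<close>, which tends to zero.\<close>
    case True
    show ?thesis
    proof (rule Lim_null_comparison)
      show "((\<lambda>y. norm c * (norm c * K) * (g y - g x - jump g x)) \<longlongrightarrow> 0) (at_right x)"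
        using tendsto_mult_left[OF lim] by simp
      show "\<forall>\<^sub>F y in at_right x. norm (g_quotient g ?E x y - c * ?E x)
          \<le> norm c * (norm c * K) * (g y - g x - jump g x)"
        using ev
      proof eventually_elim
        case (elim y)
        have pos: "0 < g y - g x" using inc elim by simp
        have "\<bar>?M y - ?M x\<bar> \<le> norm c * (?M x + ?M y) * (g y - g x)"
          using elim side by (intro exp_majorant_diff cv) auto
        also have "\<dots> \<le> norm c * K * (g y - g x)"
          using elim K pos by (intro mult_left_mono mult_right_mono) auto
        finally have "norm c * \<bar>?M y - ?M x\<bar> \<le> norm c * (norm c * K * (g y - g x))"
          by (rule mult_left_mono) simp
        then show ?case using est[of y] elim True pos by (simp add: mult.assoc)
      qed
    qed
  next
    \<comment> \<open>At a jump the majorant is merely bounded by \<open>K\<close>; the mass ratio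
      tends to zero, since its denominator is at least \<open>jump g x\<close>.\<close>
    case False
    then have j: "0 < jump g x" using jump_nonneg[of x] by simp
    show ?thesis
    proof (rule Lim_null_comparison)
      show "((\<lambda>y. norm c * K / jump g x * (g y - g x - jump g x)) \<longlongrightarrow> 0) (at_right x)"
        using tendsto_mult_left[OF lim, of "norm c * K / jump g x"] by simp
      show "\<forall>\<^sub>F y in at_right x. norm (g_quotient g ?E x y - c * ?E x)
          \<le> norm c * K / jump g x * (g y - g x - jump g x)"
        using ev
      proof eventually_elim
        case (elim y)
        have r: "0 \<le> g y - g x - jump g x" using right_limit_le[of x y] elim by simp
        have "\<bar>?M y - ?M x\<bar> \<le> K" using K[of y] nn[of x] nn[of y] elim by linarith
        moreover have "(g y - g x - jump g x) / (g y - g x) \<le> (g y - g x - jump g x) / jump g x"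
          using r j by (intro divide_left_mono) auto
        ultimately have "norm c * \<bar>?M y - ?M x\<bar> * ((g y - g x - jump g x) / (g y - g x))
            \<le> norm c * K * ((g y - g x - jump g x) / jump g x)"
          using r j by (intro mult_mono) auto
        then show ?case using est[of y] elim by simp
      qed
    qed
  qed
  then show ?thesis by (rule LIM_zero_cancel)
qed

text \<open>Left continuity gives \<open>g x - g y\<close> the limit zero even at a jump, so a
  single case remains.\<close>

lemma g_quotient_exp_left:
  fixes c :: "'a::{real_normed_field,banach}"
  assumes conv: "{l<..} \<subseteq> exp_abs_conv_set g c s" and "l < x"
    and inc: "\<And>y. y < x \<Longrightarrow> g y < g x"
  shows "(g_quotient g (exp_g g c s) x \<longlongrightarrow> c * exp_g g c s x) (at_left x)"
proof -
  let ?M = "exp_majorant g c s" and ?E = "exp_g g c s"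
  \<comment> \<open>The midpoint keeps \<open>u\<close> inside the region of convergence, and the
    maximum with \<open>s\<close> keeps \<open>[u, x]\<close> on one side of
    \<open>s\<close>.\<close>
  define u where "u = (if x \<le> s then (l + x) / 2 else max s ((l + x) / 2))"
  define K where "K = (?M u + ?M x) + ?M x"
  have u: "u < x" "l < u" "s \<le> u \<or> x \<le> s" using \<open>l < x\<close> by (auto simp: u_def less_max_iff_disj)
  have cv: "y \<in> exp_abs_conv_set g c s" if "u \<le> y" for y
    using conv that u by auto
  have lim: "((\<lambda>y. g x - g y) \<longlongrightarrow> 0) (at_left x)"
    using tendsto_diff[OF tendsto_const derivator_tendsto_left, of "g x" x] by simp
  have "((\<lambda>y. g_quotient g ?E x y - c * ?E x) \<longlongrightarrow> 0) (at_left x)"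
  proof (rule Lim_null_comparison)
    show "((\<lambda>y. norm c * (norm c * K) * (g x - g y)) \<longlongrightarrow> 0) (at_left x)"
      using tendsto_mult_left[OF lim] by simp
    have "\<forall>\<^sub>F y in at_left x. u < y \<and> y < x"
      using u by (auto simp: eventually_at_left_field)
    then show "\<forall>\<^sub>F y in at_left x. norm (g_quotient g ?E x y - c * ?E x)
        \<le> norm c * (norm c * K) * (g x - g y)"
    proof eventually_elim
      case (elim y)
      have side: "s \<le> y \<or> x \<le> s" using elim u by auto
      have pos: "0 < g x - g y" using inc elim by simp
      then have nz: "of_real (g x - g y) \<noteq> (0::'a)" by simp
      have "norm (?E x - ?E y - c * ?E x * of_real (g x - g y))
          \<le> norm c * \<bar>?M x - ?M y\<bar> * (g x - g y)"
        using elim side pos u g_monomial_left_estimate[of y x s]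
        by (intro exp_g_increment cv) auto
      moreover have "g_quotient g ?E x y - c * ?E x =
          (?E x - ?E y - c * ?E x * of_real (g x - g y)) / of_real (g x - g y)"
      proof -
        have "g_quotient g ?E x y = (?E x - ?E y) / of_real (g x - g y)"
          unfolding g_quotient_def
          using minus_divide_divide[of "?E x - ?E y" "of_real (g x - g y) :: 'a"] by simp
        then show ?thesis using nz by (simp add: diff_divide_distrib)
      qed
      ultimately have "norm (g_quotient g ?E x y - c * ?E x) \<le> norm c * \<bar>?M x - ?M y\<bar>"
        using pos by (simp add: norm_divide divide_le_eq del: of_real_diff)
      also have "\<bar>?M x - ?M y\<bar> \<le> norm c * (?M y + ?M x) * (g x - g y)"
        using elim side u by (intro exp_majorant_diff cv) auto
      also have "\<dots> \<le> norm c * K * (g x - g y)"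
        unfolding K_def using elim pos u
        by (intro mult_left_mono mult_right_mono add_right_mono exp_majorant_between cv) auto
      finally show ?case by (simp add: mult.assoc mult_left_mono)
    qed
  qed
  then show ?thesis by (rule LIM_zero_cancel)
qed

text \<open>The error bound vanishes together with the increment of \<open>g\<close>; an interval
  containing \<open>s\<close> is split there. At a constancy point the derivative is taken at the
  right end of the component, and this lemma carries the value of the series back.\<close>

lemma exp_g_eq_of_eq:
  fixes c :: "'a::{real_normed_field,banach}"
  assumes "{x..y} \<subseteq> exp_abs_conv_set g c s" and "x \<le> y" and eq: "g x = g y"
  shows "exp_g g c s x = exp_g g c s y"
proof -
  have *: "exp_g g c s a = exp_g g c s b"
    if ab: "x \<le> a" "a \<le> b" "b \<le> y" and side: "s \<le> a \<or> b \<le> s" for a b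
  proof -
    have "g a = g b" using derivator_mono[OF ab(1)] derivator_mono[OF ab(2)] derivator_mono[OF ab(3)] eq by simp
    then have d: "g b - g a = 0" by simp
    have conv: "a \<in> exp_abs_conv_set g c s" "b \<in> exp_abs_conv_set g c s"
      using assms(1) ab by auto
    have "norm (exp_g g c s b - exp_g g c s a - c * exp_g g c s b * of_real (g b - g a))
        \<le> norm c * \<bar>exp_majorant g c s b - exp_majorant g c s a\<bar> * (g b - g a)"
      using d by (intro exp_g_increment conv ab(2) side g_monomial_left_estimate) simp
    then show ?thesis by (simp add: d)
  qed
  consider "s \<le> x \<or> y \<le> s" | "x \<le> s" "s \<le> y" by linarith
  then show ?thesis
    using *[of x y] *[of x s] *[of s y] assms(2) by cases auto
qed

lemma exp_g_center:
  fixes c :: "'a::{real_normed_field,banach}"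
  shows "exp_g g c s s = 1"
proof -
  have "exp_term g c s s = (\<lambda>n. if n = 0 then 1 else 0)"
    by (auto simp: exp_term_def g_monomial_center)
  then show ?thesis
    using sums_unique[OF sums_single[of 0 "\<lambda>_. 1 :: 'a"]] by (simp add: exp_g_def)
qed

section \<open>Local constancy of a derivator and the end points of components\<close>

lemma C_setI:
  assumes "p < x" "x < q" "g p = g q"
  shows "x \<in> C_set g"
proof -
  define \<epsilon> where "\<epsilon> = min (x - p) (q - x)"
  have "0 < \<epsilon>" using assms by (simp add: \<epsilon>_def)
  moreover have "\<forall>y\<in>{x - \<epsilon><..<x + \<epsilon>}. g y = g p"
  proof
    fix y assume "y \<in> {x - \<epsilon><..<x + \<epsilon>}"
    then have "p \<le> y" "y \<le> q" by (auto simp: \<epsilon>_def)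
    then show "g y = g p"
      using derivator_mono[of p y] derivator_mono[of y q] assms(3) by simp
  qed
  ultimately show ?thesis
    unfolding C_set_def constant_on_def by blast
qed

lemma C_setE:
  assumes "x \<in> C_set g"
  obtains \<epsilon> where "0 < \<epsilon>" "\<forall>y\<in>{x - \<epsilon><..<x + \<epsilon>}. y \<in> C_set g \<and> g y = g x"
proof -
  obtain \<epsilon> k where \<epsilon>: "0 < \<epsilon>" and k: "\<forall>y\<in>{x - \<epsilon><..<x + \<epsilon>}. g y = k"
    using assms unfolding C_set_def constant_on_def by blast
  show ?thesis
  proof (rule that[OF \<epsilon>], rule ballI)
    fix y assume y: "y \<in> {x - \<epsilon><..<x + \<epsilon>}"
    \<comment> \<open>The midpoints between \<open>y\<close> and the ends of the interval enclose
      \<open>y\<close> and share the same value of \<open>g\<close>.\<close>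
    have "g ((x - \<epsilon> + y) / 2) = k" "g ((y + (x + \<epsilon>)) / 2) = k" "g y = k" "g x = k"
      using y \<epsilon> by (auto intro!: bspec[OF k])
    moreover from this have "y \<in> C_set g"
      using y by (intro C_setI[of "(x - \<epsilon> + y) / 2" y "(y + (x + \<epsilon>)) / 2"]) auto
    ultimately show "y \<in> C_set g \<and> g y = g x"
      by simp
  qed
qed

lemma open_C_set: "open (C_set g)"
proof (subst open_subopen, rule ballI)
  fix x assume "x \<in> C_set g"
  then obtain \<epsilon> where "0 < \<epsilon>" "\<forall>y\<in>{x - \<epsilon><..<x + \<epsilon>}. y \<in> C_set g \<and> g y = g x"
    by (rule C_setE)
  then show "\<exists>T. open T \<and> x \<in> T \<and> T \<subseteq> C_set g"
    by (intro exI[of _ "{x - \<epsilon><..<x + \<epsilon>}"]) auto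
qed

text \<open>The end points are the infimum and supremum taken in \<open>ereal\<close>, which covers
  unbounded components. Openness makes the inequalities strict, and connectedness fills the
  interval.\<close>

lemma C_component_exists:
  assumes "x \<in> C_set g"
  obtains a b where "C_component g a b" "a < ereal x" "ereal x < b"
proof -
  define S where "S = connected_component_set (C_set g) x"
  have S: "S \<in> components (C_set g)" "x \<in> S"
    using assms by (auto simp: S_def components_def)
  have "open S" "connected S"
    using S open_C_set open_components in_components_connected by blast+
  define a b where "a = Inf (ereal ` S)" and "b = Sup (ereal ` S)"
  have ins: "a < ereal y" "ereal y < b" if "y \<in> S" for y
  proof -
    obtain e where e: "0 < e" "ball y e \<subseteq> S"
      using openE[OF \<open>open S\<close> \<open>y \<in> S\<close>] .
    then have "y - e / 2 \<in> S" "y + e / 2 \<in> S"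
      by (auto simp: subset_iff dist_real_def)
    then have "a \<le> ereal (y - e / 2)" "ereal (y + e / 2) \<le> b"
      unfolding a_def b_def by (auto intro: Inf_lower Sup_upper)
    moreover have "ereal (y - e / 2) < ereal y" "ereal y < ereal (y + e / 2)"
      using e by simp_all
    ultimately show "a < ereal y" "ereal y < b"
      by (blast intro: le_less_trans less_le_trans)+
  qed
  have "y \<in> S" if y: "a < ereal y" "ereal y < b" for y
  proof -
    obtain z w where "z \<in> S" "z < y" "w \<in> S" "y < w"
      using y unfolding a_def b_def Inf_less_iff less_Sup_iff by auto
    then show ?thesis
      using \<open>connected S\<close> connectedD_interval[of S z w y] by auto
  qed
  then have "{y. a < ereal y \<and> ereal y < b} = S"
    using ins by auto
  then show ?thesis
    using that[of a b] S ins by (simp add: C_component_def)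
qed

lemma C_component_const:
  assumes C: "C_component g a b" and "a < ereal x" "ereal x < b" "a < ereal y" "ereal y < b"
  shows "g x = g y"
proof -
  define S where "S = {x. a < ereal x \<and> ereal x < b}"
  have "connected S"
    using C unfolding C_component_def S_def by (rule in_components_connected)
  moreover have "x \<in> S" "y \<in> S" using assms by (auto simp: S_def)
  moreover have "\<forall>z\<in>S. \<forall>\<^sub>F w in at z within S. g z = g w"
  proof
    fix z assume "z \<in> S"
    then have "z \<in> C_set g" using C_component_subset[OF C] by (simp add: S_def)
    then obtain \<epsilon> where "0 < \<epsilon>" and \<epsilon>: "\<forall>y\<in>{z - \<epsilon><..<z + \<epsilon>}. y \<in> C_set g \<and> g y = g z"
      by (rule C_setE)
    have "\<forall>w\<in>S. w \<noteq> z \<and> dist w z < \<epsilon> \<longrightarrow> g z = g w"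
    proof (intro ballI impI)
      fix w assume "w \<noteq> z \<and> dist w z < \<epsilon>"
      then have "w \<in> {z - \<epsilon><..<z + \<epsilon>}"
        by (simp add: dist_real_def abs_less_iff)
      from bspec[OF \<epsilon> this] show "g z = g w" by metis
    qed
    then show "\<forall>\<^sub>F w in at z within S. g z = g w"
      unfolding eventually_at by (intro exI[of _ \<epsilon>] conjI \<open>0 < \<epsilon>\<close>)
  qed
  ultimately show ?thesis by (rule connected_local_const[where f = g])
qed

text \<open>Left continuity carries the constant value over to \<open>b\<close>, even if
  \<open>b\<close> is a jump. If \<open>g\<close> kept this value beyond \<open>b\<close>, then
  \<open>b\<close> would be a constancy point, against maximality of the component.\<close>

lemma C_component_right_end:
  assumes C: "C_component g a (ereal b)"
  shows "b \<notin> C_set g" and "\<And>x. a < ereal x \<Longrightarrow> x < b \<Longrightarrow> g x = g b" and "\<And>y. b < y \<Longrightarrow> g b < g y"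
proof -
  obtain p where p: "a < ereal p" "p < b"
    using C_component_point[OF C] by auto
  show b: "b \<notin> C_set g"
  proof
    assume "b \<in> C_set g"
    moreover have "y \<in> C_set g" if "p \<le> y" "y < b" for y
      using C_component_subset[OF C less_le_trans[OF p(1)], of y] that by simp
    ultimately have "{p..b} \<subseteq> C_set g"
      by (auto simp: order_le_less)
    from C_component_maximal[OF C connected_Icc this, of p b] p show False by simp
  qed
  show eq: "g x = g b" if "a < ereal x" "x < b" for x
  proof -
    have "\<forall>\<^sub>F y in at_left b. g y = g x"
      unfolding eventually_at_left_field
    proof (intro exI[of _ x] conjI allI impI that(2))
      fix y assume y: "x < y" "y < b"
      then have "a < ereal y" using less_trans[OF that(1), of "ereal y"] by simp
      then show "g y = g x"
        by (rule C_component_const[OF C]) (use that y in simp_all)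
    qed
    then have "(g \<longlongrightarrow> g x) (at_left b)"
      by (rule tendsto_eventually)
    then show ?thesis
      by (rule tendsto_unique[OF trivial_limit_at_left_real _ derivator_tendsto_left])
  qed
  show "g b < g y" if "b < y" for y
  proof -
    have "g p \<noteq> g y" using C_setI[OF p(2) that] b by blast
    then show ?thesis using eq[OF p] derivator_mono[of b y] that by simp
  qed
qed

text \<open>Left continuity does not connect \<open>g a\<close> with the values to its right; the
  absence of a jump does. An equal value to the left of \<open>a\<close> would then make
  \<open>a\<close> a constancy point.\<close>

lemma C_component_left_end:
  assumes C: "C_component g (ereal a) b" and j: "jump g a = 0"
    and a: "a \<notin> C_set g" and y: "y < a"
  shows "g y < g a"
proof -
  obtain p where p: "a < p" "ereal p < b"
    using C_component_point[OF C] by auto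
  have "\<forall>\<^sub>F y in at_right a. g y = g p"
    unfolding eventually_at_right_field
  proof (intro exI[of _ p] conjI allI impI p(1))
    fix y assume y: "a < y" "y < p"
    then have yb: "ereal y < b" using less_trans[OF _ p(2), of "ereal y"] by simp
    show "g y = g p"
      by (rule C_component_const[OF C]) (use p y yb in simp_all)
  qed
  then have "(g \<longlongrightarrow> g p) (at_right a)"
    by (rule tendsto_eventually)
  then have "g p = g a + jump g a"
    by (rule tendsto_unique[OF trivial_limit_at_right_real _ tendsto_at_right_jump])
  then have "g p = g a" using j by simp
  moreover have "g y \<noteq> g p" using C_setI[OF y p(1)] a by blast
  ultimately show "g y < g a"
    using derivator_mono[of y a] y by simp
qed

section \<open>Strict growth outside the exceptional sets, and the differential equation\<close>

lemma D_set_iff: "x \<in> D_set g \<longleftrightarrow> jump g x \<noteq> 0"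
  using jump_nonneg[of x] by (auto simp: D_set_def)

text \<open>If \<open>g\<close> were constant on \<open>[x, y]\<close>, the component just to the
  right of \<open>x\<close> would begin exactly at \<open>x\<close>, and \<open>x\<close> would
  belong to \<open>N_minus g\<close>.\<close>

lemma strict_right_of_N_minus:
  assumes x: "x \<notin> C_set g" "x \<notin> D_set g" "ereal x \<notin> N_minus g" and "x < y"
  shows "g x < g y"
proof (rule ccontr)
  assume "\<not> g x < g y"
  then have eq: "g x = g y" using derivator_mono[of x y] \<open>x < y\<close> by simp
  then have sub: "{x<..<y} \<subseteq> C_set g" using C_setI by auto
  obtain z where z: "x < z" "z < y" using dense \<open>x < y\<close> by blast
  then have "z \<in> C_set g" using sub by auto
  then obtain a b where ab: "C_component g a b" "a < ereal z" "ereal z < b"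
    by (rule C_component_exists)
  have "a < ereal w" if "x < w" "w < z" for w
    using C_component_maximal[OF ab(1) connected_Ioo sub ab(2,3), of w] that z by simp
  then have "a \<le> ereal x"
    by (intro ereal_le_of_dense_right[OF z(1)] less_imp_le)
  moreover have "\<not> a < ereal x"
    using C_component_subset[OF ab(1), of x] x(1) less_trans[OF _ ab(3), of "ereal x"] z by auto
  ultimately have "a = ereal x" by simp
  moreover have "ereal x \<notin> ereal ` D_set g" using x(2) by auto
  ultimately have "ereal x \<in> N_minus g"
    using ab(1) unfolding N_minus_def by blast
  then show False using x(3) by simp
qed

text \<open>Mirror image: a component would end exactly at \<open>x\<close>.\<close>

lemma strict_left_of_N_plus:
  assumes x: "x \<notin> C_set g" "x \<notin> D_set g" "ereal x \<notin> N_plus g" and "y < x"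
  shows "g y < g x"
proof (rule ccontr)
  assume "\<not> g y < g x"
  then have eq: "g y = g x" using derivator_mono[of y x] \<open>y < x\<close> by simp
  then have sub: "{y<..<x} \<subseteq> C_set g" using C_setI by auto
  obtain z where z: "y < z" "z < x" using dense \<open>y < x\<close> by blast
  then have "z \<in> C_set g" using sub by auto
  then obtain a b where ab: "C_component g a b" "a < ereal z" "ereal z < b"
    by (rule C_component_exists)
  have "ereal w < b" if "z < w" "w < x" for w
    using C_component_maximal[OF ab(1) connected_Ioo sub ab(2,3), of w] that z by simp
  then have "ereal x \<le> b"
    by (intro ereal_ge_of_dense_left[OF z(2)] less_imp_le)
  moreover have "\<not> ereal x < b"
    using C_component_subset[OF ab(1), of x] x(1) less_trans[OF ab(2), of "ereal x"] z by auto
  ultimately have "b = ereal x" by simp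
  moreover have "ereal x \<notin> ereal ` D_set g" using x(2) by auto
  ultimately have "ereal x \<in> N_plus g"
    using ab(1) unfolding N_plus_def by blast
  then show False using x(3) by simp
qed

text \<open>The cases follow the definition of the derivative. Each supplies strict growth of
  \<open>g\<close> on the sides from which the limit is taken, which is what the two limit lemmas
  ask for.\<close>

lemma exp_g_has_g_derivative:
  fixes c :: "'a::{real_normed_field,banach}"
  assumes N: "\<infinity> \<notin> N_plus g" and conv: "{l<..} \<subseteq> exp_abs_conv_set g c s" and "l < x"
  shows "has_g_derivative g {l<..} (exp_g g c s) (c * exp_g g c s x) x"
proof -
  \<comment> \<open>An infinite right end would lie in \<open>N_plus g\<close>, as
    \<open>D_set g\<close> contains only real numbers. Finite right ends make the half-line an
    admissible domain.\<close>
  have fin: "\<exists>b'. b = ereal b' \<and> y < b'" if "C_component g a b" "ereal y < b" for a b y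
    using that N by (cases b) (auto simp: N_plus_def)
  have "g_domain g {l<..}"
    unfolding g_domain_def
  proof (intro conjI allI ballI impI)
    fix a b y
    assume "y \<in> {l<..}" and ab: "C_component g a b \<and> a < ereal y \<and> ereal y < b"
    then obtain b' where "b = ereal b'" "y < b'" using fin by blast
    then show "b \<in> ereal ` {l<..}" using \<open>y \<in> {l<..}\<close> by simp
  qed simp
  moreover consider "x \<in> D_set g" | "x \<notin> D_set g" "x \<in> C_set g"
    | "x \<notin> D_set g" "x \<notin> C_set g" "ereal x \<in> N_plus g"
    | "x \<notin> D_set g" "x \<notin> C_set g" "ereal x \<notin> N_plus g" "ereal x \<in> N_minus g"
    | "x \<notin> D_set g" "x \<notin> C_set g" "ereal x \<notin> N_plus g" "ereal x \<notin> N_minus g" by blast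
  then have "if x \<in> D_set g then (g_quotient g (exp_g g c s) x \<longlongrightarrow> c * exp_g g c s x) (at_right x)
      else if x \<in> C_set g then
        (\<exists>a b. C_component g a (ereal b) \<and> a < ereal x \<and> x < b \<and>
               (g_quotient g (exp_g g c s) b \<longlongrightarrow> c * exp_g g c s x) (at_right b))
      else if ereal x \<in> N_plus g then (g_quotient g (exp_g g c s) x \<longlongrightarrow> c * exp_g g c s x) (at_right x)
      else if ereal x \<in> N_minus g then (g_quotient g (exp_g g c s) x \<longlongrightarrow> c * exp_g g c s x) (at_left x)
      else (g_quotient g (exp_g g c s) x \<longlongrightarrow> c * exp_g g c s x) (at x)"
  proof cases
    case 1
    then have "g x < g y" if "x < y" for y
      using right_limit_le[OF that] by (simp add: D_set_def)
    then show ?thesis using 1 g_quotient_exp_right[OF conv \<open>l < x\<close>] by simp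
  next
    case 2
    obtain a b where ab: "C_component g a (ereal b)" "a < ereal x" "x < b"
    proof -
      obtain a b where *: "C_component g a b" "a < ereal x" "ereal x < b"
        using C_component_exists[OF 2(2)] .
      then show ?thesis using fin[of a b x] that by blast
    qed
    have "exp_g g c s x = exp_g g c s b"
      using ab conv \<open>l < x\<close> C_component_right_end(2)[OF ab] by (intro exp_g_eq_of_eq) auto
    moreover have "(g_quotient g (exp_g g c s) b \<longlongrightarrow> c * exp_g g c s b) (at_right b)"
      using ab \<open>l < x\<close> C_component_right_end(3)[OF ab(1)] by (intro g_quotient_exp_right[OF conv]) auto
    ultimately show ?thesis using 2 ab by auto
  next
    case 3
    then obtain a where "C_component g a (ereal x)" by (auto simp: N_plus_def)
    then show ?thesis
      using 3 C_component_right_end(3) g_quotient_exp_right[OF conv \<open>l < x\<close>] by simp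
  next
    case 4
    then obtain b where "C_component g (ereal x) b" by (auto simp: N_minus_def)
    then have "g y < g x" if "y < x" for y
      using 4(1,2) that by (intro C_component_left_end) (simp_all add: D_set_iff)
    then show ?thesis using 4 g_quotient_exp_left[OF conv \<open>l < x\<close>] by simp
  next
    \<comment> \<open>Outside both exceptional sets \<open>g\<close> grows strictly on both sides,
      and the two one-sided limits combine.\<close>
    case 5
    then show ?thesis
      using filterlim_split_at[OF
          g_quotient_exp_left[OF conv \<open>l < x\<close> strict_left_of_N_plus[OF 5(2,1,3)]]
          g_quotient_exp_right[OF conv \<open>l < x\<close> strict_right_of_N_minus[OF 5(2,1,4)]]]
      by simp
  qed
  ultimately show ?thesis
    using \<open>l < x\<close> by (simp add: has_g_derivative_def)
qed

end

theorem theorem5p11: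
  fixes g :: "real \<Rightarrow> real" and s :: real
  assumes "derivator g" and "\<infinity> \<notin> N_plus g"
  shows "(\<forall>c::real. c \<noteq> 0 \<longrightarrow>
            (\<forall>\<delta>>0. {s - \<delta><..} \<subseteq> exp_max_interval g c s \<longrightarrow>
               (\<forall>x\<in>{s - \<delta><..}. has_g_derivative g {s - \<delta><..} (exp_g g c s) (c * exp_g g c s x) x) \<and>
               exp_g g c s s = 1)) \<and>
         (\<forall>c::complex. c \<noteq> 0 \<longrightarrow>
            (\<forall>\<delta>>0. {s - \<delta><..} \<subseteq> exp_max_interval g c s \<longrightarrow>
               (\<forall>x\<in>{s - \<delta><..}. has_g_derivative g {s - \<delta><..} (exp_g g c s) (c * exp_g g c s x) x) \<and>
               exp_g g c s s = 1))"
  \<comment> \<open>Both fields are instances of the same lemma with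
    \<open>l = s - \<delta>\<close>, since the series converges absolutely on the maximal
    interval.\<close>
  by (intro conjI allI impI ballI exp_g_center[OF assms(1)]
      exp_g_has_g_derivative[OF assms subset_trans[OF _ exp_max_interval_subset]])
    (assumption | simp)+

end
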